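(* Assume the standing assumptions below and let $X_*$ be the unique symmetric positive semidefinite solution of $$\mathscr R(X):=A^{\mathsf T}X+XA+Q+\Pi_{11}(X)-[XB+L+\Pi_{12}(X)][R+\Pi_{22}(X)]^{-1}[XB+L+\Pi_{12}(X)]^{\mathsf T}=0.$$ Let $X_0=0$ and, for $k\ge0$, let $X_{k+1}$ be the stabilizing solution of the CARE $A_k^{\mathsf T}X+XA_k-XG_kX+H_k=0$ with $A_k=A_{\mathrm c}(X_k)$, $G_k=G_{\mathrm c}(X_k)$, $H_k=H_{\mathrm c}(X_k)$. Then: (i) $0=X_0\preceq X_1\preceq\cdots\preceq X_k\preceq X_*$, $\mathscr R(X_k)\succeq0$, and all eigenvalues of $A_k-G_kX_*$ lie in the open left half-plane, for all $k\ge0$; (ii) $\lim_{k\to\infty}X_k=X_*\succeq0$ and all eigenvalues of $A_{\mathrm c}(X_* )-G_{\mathrm c}(X_* )X_*$ lie in the closed left half-plane $\{\mathrm{Re}\,\lambda\le 0\}$.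
   Context: Data: $A,Q\in\mathbb{R}^{n\times n}$, $B,L\in\mathbb{R}^{n\times m}$, $R\in\mathbb{R}^{m\times m}$, $A_0^i\in\mathbb{R}^{n\times n}$, $B_0^i\in\mathbb{R}^{n\times m}$ ($i=1,\dots,r$); $A_0^0=A$, $B_0^0=B$. For symmetric $X$: $\Pi_{11}(X)=\sum_{i=1}^r (A_0^i)^{\mathsf T}XA_0^i$, $\Pi_{12}(X)=\sum_i (A_0^i)^{\mathsf T}XB_0^i$, $\Pi_{22}(X)=\sum_i (B_0^i)^{\mathsf T}XB_0^i$; $L_{\mathrm c}=L+\Pi_{12}$, $R_{\mathrm c}=R+\Pi_{22}$, $Q_{\mathrm c}=Q+\Pi_{11}$; $A_{\mathrm c}(X)=A-BR_{\mathrm c}(X)^{-1}L_{\mathrm c}(X)^{\mathsf T}$, $G_{\mathrm c}(X)=BR_{\mathrm c}(X)^{-1}B^{\mathsf T}$, $H_{\mathrm c}(X)=Q_{\mathrm c}(X)-L_{\mathrm c}(X)R_{\mathrm c}(X)^{-1}L_{\mathrm c}(X)^{\mathsf T}$. Standing assumptions: (1) $R\succ0$, $\begin{bmatrix}Q&L\\L^{\mathsf T}&R\end{bmatrix}\succeq0$; (2) there is $F\in\mathbb{R}^{m\times n}$ with $\dot S=(A+BF)S+S(A+BF)^{\mathsf T}+\sum_{i=1}^r(A_0^i+B_0^iF)S(A_0^i+B_0^iF)^{\mathsf T}$ exponentially stable; (3) with $C^{\mathsf T}C=Q-LR^{-1}L^{\mathsf T}$, $C\in\mathbb{R}^{p\times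 n}$, and $\widetilde A_0^i=A_0^i-B_0^iR^{-1}L^{\mathsf T}$, there is $K\in\mathbb{R}^{n\times p}$ with $\dot S=(\widetilde A_0^0+KC)S+S(\widetilde A_0^0+KC)^{\mathsf T}+\sum_{i=1}^r\widetilde A_0^iS(\widetilde A_0^i)^{\mathsf T}$ exponentially stable; (4) $\mathcal N(Q-LR^{-1}L^{\mathsf T})\subseteq\mathcal N(L^{\mathsf T})\cap\bigcap_i\mathcal N(A_0^i)$; (5) $(A,B)$ stabilizable and $(Q-LR^{-1}L^{\mathsf T},A)$ detectable (standard PBH-type definitions). Under (1)–(3), the equation $\mathscr R(X)=0$ has a unique positive semidefinite solution $X_*$, which is stabilizing. A stabilizing solution of a CARE $\mathcal A^{\mathsf T}X+X\mathcal A-X\mathcal GX+\mathcal H=0$ is a symmetric solution with $\mathcal A-\mathcal GX$ having all eigenvalues in the open left half-plane. *)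

theory Defs
  imports "HOL-Analysis.Analysis"
begin

type_synonym ('r,'c) rmat = "real^'c^'r"   (* 'r rows, 'c columns *)

definition sym_mat :: "real^'n^'n \<Rightarrow> bool" where
  "sym_mat X \<longleftrightarrow> transpose X = X"

definition psd :: "real^'n^'n \<Rightarrow> bool" where
  "psd M \<longleftrightarrow> sym_mat M \<and> (\<forall>x. 0 \<le> x \<bullet> (M *v x))"

definition pd :: "real^'n^'n \<Rightarrow> bool" where
  "pd M \<longleftrightarrow> sym_mat M \<and> (\<forall>x. x \<noteq> 0 \<longrightarrow> 0 < x \<bullet> (M *v x))"

definition loewner_le :: "real^'n^'n \<Rightarrow> real^'n^'n \<Rightarrow> bool" where
  "loewner_le X Y \<longleftrightarrow> psd (Y - X)"

definition block_mat ::
  "real^'n^'n \<Rightarrow> real^'m^'n \<Rightarrow> real^'n^'m \<Rightarrow> real^'m^'m \<Rightarrow> real^('n+'m)^('n+'m)" where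
  "block_mat P S T U = (\<chi> i j. case i of
       Inl a \<Rightarrow> (case j of Inl b \<Rightarrow> P$a$b | Inr b \<Rightarrow> S$a$b)
     | Inr a \<Rightarrow> (case j of Inl b \<Rightarrow> T$a$b | Inr b \<Rightarrow> U$a$b))"

definition cmat :: "real^'c^'r \<Rightarrow> complex^'c^'r" where
  "cmat M = (\<chi> i j. complex_of_real (M$i$j))"

definition eigenvalue :: "real^'n^'n \<Rightarrow> complex \<Rightarrow> bool" where
  "eigenvalue M z \<longleftrightarrow> (\<exists>v. v \<noteq> 0 \<and> cmat M *v v = z *s v)"

definition hurwitz :: "real^'n^'n \<Rightarrow> bool" where
  "hurwitz M \<longleftrightarrow> (\<forall>z. eigenvalue M z \<longrightarrow> Re z < 0)"

definition exp_stable :: "(real^'n^'n \<Rightarrow> real^'n^'n) \<Rightarrow> bool" where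
  "exp_stable Op \<longleftrightarrow> (\<exists>c \<alpha>. 0 < \<alpha> \<and>
     (\<forall>S :: real \<Rightarrow> real^'n^'n.
        sym_mat (S 0) \<and> (\<forall>t\<ge>0. (S has_vector_derivative Op (S t)) (at t within {0..}))
        \<longrightarrow> (\<forall>t\<ge>0. norm (S t) \<le> c * exp (- \<alpha> * t) * norm (S 0))))"

text \<open>PBH stabilizability of (A,B) and detectability of (M,A).\<close>
definition stabilizable :: "real^'n^'n \<Rightarrow> real^'m^'n \<Rightarrow> bool" where
  "stabilizable A B \<longleftrightarrow> (\<forall>z (w::complex^'n). 0 \<le> Re z \<and> w v* cmat A = z *s w \<and> w v* cmat B = 0
      \<longrightarrow> w = 0)"

definition detectable :: "real^'n^'p \<Rightarrow> real^'n^'n \<Rightarrow> bool" where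
  "detectable M A \<longleftrightarrow> (\<forall>z (v::complex^'n). 0 \<le> Re z \<and> cmat A *v v = z *s v \<and> cmat M *v v = 0
      \<longrightarrow> v = 0)"

text \<open>The operators Pi_11, Pi_12, Pi_22 (noise matrices A0 i, B0 i, i = 1..r).\<close>
definition Pi11 :: "nat \<Rightarrow> (nat \<Rightarrow> real^'n^'n) \<Rightarrow> real^'n^'n \<Rightarrow> real^'n^'n" where
  "Pi11 r A0 X = (\<Sum>i=1..r. transpose (A0 i) ** X ** A0 i)"

definition Pi12 :: "nat \<Rightarrow> (nat \<Rightarrow> real^'n^'n) \<Rightarrow> (nat \<Rightarrow> real^'m^'n) \<Rightarrow> real^'n^'n \<Rightarrow> real^'m^'n" where
  "Pi12 r A0 B0 X = (\<Sum>i=1..r. transpose (A0 i) ** X ** B0 i)"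

definition Pi22 :: "nat \<Rightarrow> (nat \<Rightarrow> real^'m^'n) \<Rightarrow> real^'n^'n \<Rightarrow> real^'m^'m" where
  "Pi22 r B0 X = (\<Sum>i=1..r. transpose (B0 i) ** X ** B0 i)"

definition riccati ::
  "real^'n^'n \<Rightarrow> real^'m^'n \<Rightarrow> real^'n^'n \<Rightarrow> real^'m^'n \<Rightarrow> real^'m^'m \<Rightarrow> nat \<Rightarrow>
   (nat \<Rightarrow> real^'n^'n) \<Rightarrow> (nat \<Rightarrow> real^'m^'n) \<Rightarrow> real^'n^'n \<Rightarrow> real^'n^'n" where
  "riccati A B Q L R r A0 B0 X =
     transpose A ** X + X ** A + Q + Pi11 r A0 X
     - (X ** B + L + Pi12 r A0 B0 X) ** matrix_inv (R + Pi22 r B0 X)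
       ** transpose (X ** B + L + Pi12 r A0 B0 X)"

definition Lc where "Lc L r A0 B0 X = L + Pi12 r A0 B0 X"
definition Rc where "Rc R r B0 X = R + Pi22 r B0 X"
definition Qc where "Qc Q r A0 X = Q + Pi11 r A0 X"

definition Ac ::
  "real^'n^'n \<Rightarrow> real^'m^'n \<Rightarrow> real^'m^'n \<Rightarrow> real^'m^'m \<Rightarrow> nat \<Rightarrow>
   (nat \<Rightarrow> real^'n^'n) \<Rightarrow> (nat \<Rightarrow> real^'m^'n) \<Rightarrow> real^'n^'n \<Rightarrow> real^'n^'n" where
  "Ac A B L R r A0 B0 X = A - B ** matrix_inv (Rc R r B0 X) ** transpose (Lc L r A0 B0 X)"

definition Gc ::
  "real^'m^'n \<Rightarrow> real^'m^'m \<Rightarrow> nat \<Rightarrow> (nat \<Rightarrow> real^'m^'n) \<Rightarrow> real^'n^'n \<Rightarrow> real^'n^'n" where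
  "Gc B R r B0 X = B ** matrix_inv (Rc R r B0 X) ** transpose B"

definition Hc ::
  "real^'n^'n \<Rightarrow> real^'m^'n \<Rightarrow> real^'m^'m \<Rightarrow> nat \<Rightarrow>
   (nat \<Rightarrow> real^'n^'n) \<Rightarrow> (nat \<Rightarrow> real^'m^'n) \<Rightarrow> real^'n^'n \<Rightarrow> real^'n^'n" where
  "Hc Q L R r A0 B0 X = Qc Q r A0 X
     - Lc L r A0 B0 X ** matrix_inv (Rc R r B0 X) ** transpose (Lc L r A0 B0 X)"

definition stabilizing_care_sol ::
  "real^'n^'n \<Rightarrow> real^'n^'n \<Rightarrow> real^'n^'n \<Rightarrow> real^'n^'n \<Rightarrow> bool" where
  "stabilizing_care_sol \<A> \<G> \<H> X \<longleftrightarrow>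
     sym_mat X \<and> transpose \<A> ** X + X ** \<A> - X ** \<G> ** X + \<H> = 0 \<and> hurwitz (\<A> - \<G> ** X)"

end

theory Submission
  imports Defs "HOL-Computational_Algebra.Fundamental_Theorem_Algebra"
begin

text \<open>
  Let \<open>Psi Y X\<close> be the Riccati expression in which the noise operators are evaluated at \<open>Y\<close> and
  the drift terms at \<open>X\<close>. Its quadratic form is the minimum over controls of a form that is
  increasing in \<open>Y\<close>, so \<open>Psi\<close> is monotone in \<open>Y\<close>. If \<open>Psi Y X \<preceq> 0\<close> with \<open>X, Y \<succeq> 0\<close>, then on an
  unstable eigenvector of the closed loop the running cost vanishes; the kernel condition makes the
  feedback vanish there, which contradicts detectability. Hence the closed loops are Hurwitz, and
  Lyapunov's theorem compares the iterates with each other and with \<open>X\<^sub>*\<close>.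

  The monotone limit \<open>Y \<preceq> X\<^sub>*\<close> solves \<open>Psi Y Y = 0\<close>. On the closed loop of \<open>Y\<close> the noise is dominated
  by the running cost, again by the kernel condition, so the bound \<open>X\<^sub>* - Y \<preceq> \<kappa> Y\<close> can be contracted
  geometrically, and \<open>Y = X\<^sub>*\<close>.
\<close>

section \<open>Powers of complex matrices\<close>

text \<open>Once the forcing is below \<open>\<epsilon> / 2 * (1 - q)\<close>, the comparison map
  \<open>t \<mapsto> q * t + \<epsilon> / 2 * (1 - q)\<close> has the fixed point
  \<open>\<epsilon> / 2\<close>, and the initial excess decays like \<open>q ^ j\<close>.\<close>

lemma perturbed_contraction_tendsto_zero:
  fixes a e :: "nat \<Rightarrow> real"
  assumes q: "0 \<le> q" "q < 1" and nonneg: "\<And>k. 0 \<le> a k"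
    and step: "\<And>k. a (Suc k) \<le> q * a k + e k" and e: "e \<longlonglongrightarrow> 0"
  shows "a \<longlonglongrightarrow> 0"
proof (rule LIMSEQ_I)
  fix \<epsilon> :: real assume "0 < \<epsilon>"
  then have "0 < \<epsilon> / 2 * (1 - q)" using q by simp
  from LIMSEQ_D[OF e this] obtain K where K: "\<And>k. k \<ge> K \<Longrightarrow> \<bar>e k\<bar> < \<epsilon> / 2 * (1 - q)"
    by auto
  have bound: "a (K + j) \<le> q ^ j * a K + \<epsilon> / 2" for j
  proof (induction j)
    case 0
    then show ?case using \<open>0 < \<epsilon>\<close> by simp
  next
    case (Suc j)
    have "a (K + Suc j) \<le> q * a (K + j) + \<epsilon> / 2 * (1 - q)"
      using step[of "K + j"] K[of "K + j"] by simp
    also have "\<dots> \<le> q * (q ^ j * a K + \<epsilon> / 2) + \<epsilon> / 2 * (1 - q)"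
      using Suc q by (simp add: mult_left_mono)
    also have "\<dots> = q ^ Suc j * a K + \<epsilon> / 2" by (simp add: field_simps)
    finally show ?case .
  qed
  have "(\<lambda>j. q ^ j * a K) \<longlonglongrightarrow> 0"
    using LIMSEQ_power_zero[of q] q tendsto_mult_left_zero by auto
  from LIMSEQ_D[OF this, of "\<epsilon> / 2"] \<open>0 < \<epsilon>\<close>
  obtain J where J: "\<And>j. j \<ge> J \<Longrightarrow> \<bar>q ^ j * a K\<bar> < \<epsilon> / 2" by auto
  have "norm (a k - 0) < \<epsilon>" if "k \<ge> K + J" for k
  proof -
    have "\<bar>q ^ (k - K) * a K\<bar> < \<epsilon> / 2" using J[of "k - K"] that by linarith
    then show ?thesis using bound[of "k - K"] nonneg[of k] that by simp
  qed
  then show "\<exists>no. \<forall>k\<ge>no. norm (a k - 0) < \<epsilon>" by blast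
qed

text \<open>This is \<open>p(T) v\<close>, written with iterates on one vector, so that the
  annihilating polynomial may depend on \<open>v\<close>.\<close>

definition poly_mat_apply :: "complex^'n^'n \<Rightarrow> complex poly \<Rightarrow> complex^'n \<Rightarrow> complex^'n" where
  "poly_mat_apply T p v = (\<Sum>i\<le>degree p. coeff p i *s ((*v) T ^^ i) v)"

lemma poly_mat_apply_bound:
  assumes "degree p \<le> n"
  shows "poly_mat_apply T p v = (\<Sum>i\<le>n. coeff p i *s ((*v) T ^^ i) v)"
  unfolding poly_mat_apply_def
  by (rule sum.mono_neutral_left) (use assms in \<open>auto simp: coeff_eq_0\<close>)

lemma matrix_vector_mult_sum_right: "M *v (\<Sum>i\<in>I. f i) = (\<Sum>i\<in>I. M *v f i)"
  for M :: "complex^'n^'m"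
  by (induction I rule: infinite_finite_induct) (auto simp: matrix_vector_right_distrib)

lemma poly_mat_apply_pCons:
  "poly_mat_apply T (pCons a p) v = a *s v + T *v poly_mat_apply T p v"
proof -
  have "poly_mat_apply T (pCons a p) v =
      (\<Sum>i\<le>Suc (degree p). coeff (pCons a p) i *s ((*v) T ^^ i) v)"
    by (rule poly_mat_apply_bound) (rule degree_pCons_le)
  also have "\<dots> = a *s v + T *v poly_mat_apply T p v"
    by (simp add: sum.atMost_Suc_shift poly_mat_apply_def matrix_vector_mult_sum_right vec.scale
        del: sum.atMost_Suc)
  finally show ?thesis .
qed

lemma poly_mat_apply_0 [simp]: "poly_mat_apply T 0 v = 0"
  by (simp add: poly_mat_apply_def)

lemma poly_mat_apply_linear_factor:
  "poly_mat_apply T ([:-\<mu>, 1:] * p) v = T *v poly_mat_apply T p v - \<mu> *s poly_mat_apply T p v"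
proof -
  let ?n = "Suc (degree p)"
  have "poly_mat_apply T ([:-\<mu>, 1:] * p) v =
      (\<Sum>i\<le>?n. (coeff (pCons 0 p) i - \<mu> * coeff p i) *s ((*v) T ^^ i) v)"
    by (subst poly_mat_apply_bound[of _ ?n]) (use degree_mult_le[of "[:-\<mu>,1:]" p] in auto)
  also have "\<dots> = (\<Sum>i\<le>?n. coeff (pCons 0 p) i *s ((*v) T ^^ i) v)
      - \<mu> *s (\<Sum>i\<le>?n. coeff p i *s ((*v) T ^^ i) v)"
    by (simp add: vec.scale_sum_right sum_subtractf[symmetric] vec.scale_left_diff_distrib
        del: sum.atMost_Suc)
  also have "\<dots> = poly_mat_apply T (pCons 0 p) v - \<mu> *s poly_mat_apply T p v"
    by (subst (1 2) poly_mat_apply_bound[of _ ?n]) (auto simp: degree_pCons_le)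
  finally show ?thesis by (simp add: poly_mat_apply_pCons)
qed

lemma poly_mat_apply_shifted_vector:
  "poly_mat_apply T p (T *v v - \<mu> *s v) = T *v poly_mat_apply T p v - \<mu> *s poly_mat_apply T p v"
  by (induction p)
    (auto simp: poly_mat_apply_pCons vec.scale vec.scale_right_distrib vec.scale_right_diff_distrib
      vec.add vec.diff mult.commute)

text \<open>The Krylov sequence of \<open>v\<close> outgrows the dimension, hence is linearly
  dependent; the coefficients of a relation form the polynomial.\<close>

lemma annihilating_poly_exists:
  fixes T :: "complex^'n^'n"
  obtains p where "p \<noteq> 0" "poly_mat_apply T p v = 0"
proof -
  let ?f = "\<lambda>i. ((*v) T ^^ i) v"
  \<comment> \<open>This is the real dimension, because the dependence used below is over the reals;
    its coefficients are then embedded into the complex numbers.\<close>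
  let ?N = "DIM(complex^'n)"
  have "\<exists>c :: nat \<Rightarrow> complex. (\<exists>i\<le>?N. c i \<noteq> 0) \<and> (\<Sum>i\<le>?N. c i *s ?f i) = 0"
  proof (cases "inj_on ?f {..?N}")
    case True
    then have "card (?f ` {..?N}) > ?N" by (simp add: card_image)
    then have "dependent (?f ` {..?N})" by (intro dependent_biggerset) auto
    then obtain u where u: "\<exists>w\<in>?f ` {..?N}. u w \<noteq> 0" "(\<Sum>w\<in>?f ` {..?N}. u w *\<^sub>R w) = 0"
      by (auto simp: real_vector.dependent_finite)
    have scale: "of_real a *s w = a *\<^sub>R w" for a and w :: "complex^'n"
      by (simp add: vec_eq_iff) (simp add: scaleR_conv_of_real)
    have "(\<Sum>i\<le>?N. of_real (u (?f i)) *s ?f i) = 0"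
      using u(2) unfolding sum.reindex[OF True] by (simp add: scale)
    then show ?thesis using u(1) by (intro exI[of _ "\<lambda>i. of_real (u (?f i))"]) auto
  next
    case False
    \<comment> \<open>Coinciding iterates collapse in the image set, so counting gives nothing here;
      their difference is itself the relation.\<close>
    then obtain i j where ij: "i \<le> ?N" "j \<le> ?N" "i \<noteq> j" "?f i = ?f j" by (auto simp: inj_on_def)
    let ?c = "\<lambda>k. if k = i then 1 else if k = j then -1 else (0::complex)"
    have "(\<Sum>k\<le>?N. ?c k *s ?f k) = (\<Sum>k\<in>{i, j}. ?c k *s ?f k)"
      by (rule sum.mono_neutral_right) (use ij in auto)
    also have "\<dots> = 0" using ij by (simp add: vec_eq_iff)
    finally show ?thesis using ij(1) by (intro exI[of _ ?c]) auto
  qed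
  then obtain c :: "nat \<Rightarrow> complex" and i where c: "i \<le> ?N" "c i \<noteq> 0" "(\<Sum>i\<le>?N. c i *s ?f i) = 0"
    by blast
  define p where "p = (\<Sum>i\<le>?N. monom (c i) i)"
  have coeff: "coeff p i = (if i \<le> ?N then c i else 0)" for i
    by (auto simp: p_def coeff_sum)
  then have "degree p \<le> ?N" by (intro degree_le) auto
  show ?thesis
  proof
    show "p \<noteq> 0" using c coeff[of i] by auto
    show "poly_mat_apply T p v = 0"
      using c(3) by (subst poly_mat_apply_bound[OF \<open>degree p \<le> ?N\<close>]) (simp add: coeff)
  qed
qed

text \<open>Induction on the degree of a polynomial annihilating \<open>v\<close> replaces the
  Jordan form. Split off a root \<open>\<mu>\<close>: if \<open>cmod \<mu> < 1\<close>, the iterates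
  of \<open>v\<close> follow a contraction driven by those of \<open>(T - \<mu>) v\<close>, which
  the cofactor annihilates; otherwise the cofactor already annihilates \<open>v\<close>, since its
  value would be a forbidden eigenvector.\<close>

lemma matrix_iterates_tendsto_zero:
  fixes T :: "complex^'n^'n"
  assumes ev: "\<And>\<mu> v. v \<noteq> 0 \<Longrightarrow> T *v v = \<mu> *s v \<Longrightarrow> cmod \<mu> < 1"
  shows "(\<lambda>k. ((*v) T ^^ k) v) \<longlonglongrightarrow> 0"
proof -
  have "p \<noteq> 0 \<Longrightarrow> poly_mat_apply T p v = 0 \<Longrightarrow> (\<lambda>k. ((*v) T ^^ k) v) \<longlonglongrightarrow> 0" for p v
  proof (induction "degree p" arbitrary: p v)
    case 0
    then obtain a where "p = [:a:]" "a \<noteq> 0" by (metis degree_eq_zeroE pCons_0_0)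
    then have "v = 0" using 0 by (simp add: poly_mat_apply_pCons)
    then have "((*v) T ^^ k) v = 0" for k by (induction k) auto
    then show ?case by simp
  next
    case (Suc d)
    then have "\<not> constant (poly p)" by (simp add: constant_degree)
    then obtain \<mu> where "poly p \<mu> = 0" using fundamental_theorem_of_algebra by blast
    then obtain q where pq: "p = [:-\<mu>, 1:] * q" by (auto simp: poly_eq_0_iff_dvd)
    then have q0: "q \<noteq> 0" using Suc.prems(1) by fastforce
    have "degree p = Suc (degree q)"
      unfolding pq by (subst degree_mult_eq) (use q0 in simp_all)
    then have q: "q \<noteq> 0" "degree q = d" using Suc.hyps(2) q0 by simp_all
    have root: "T *v poly_mat_apply T q v - \<mu> *s poly_mat_apply T q v = 0"
      using Suc.prems(2) by (simp only: pq poly_mat_apply_linear_factor)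
    show ?case
    proof (cases "cmod \<mu> < 1")
      case True
      let ?w = "T *v v - \<mu> *s v"
      have lim: "(\<lambda>k. ((*v) T ^^ k) ?w) \<longlonglongrightarrow> 0"
        using Suc.hyps(1)[of q ?w] q root by (simp add: poly_mat_apply_shifted_vector)
      have step: "((*v) T ^^ Suc k) v = \<mu> *s ((*v) T ^^ k) v + ((*v) T ^^ k) ?w" for k
        by (induction k) (auto simp: vec.add vec.scale)
      have "(\<lambda>k. ((*v) T ^^ k) v $ i) \<longlonglongrightarrow> 0" for i
      proof (rule tendsto_norm_zero_cancel,
          rule perturbed_contraction_tendsto_zero[where q = "cmod \<mu>"
            and e = "\<lambda>k. cmod (((*v) T ^^ k) ?w $ i)"])
        show "cmod (((*v) T ^^ Suc k) v $ i)
            \<le> cmod \<mu> * cmod (((*v) T ^^ k) v $ i) + cmod (((*v) T ^^ k) ?w $ i)" for k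
          unfolding step
          using norm_triangle_ineq[of "\<mu> * ((*v) T ^^ k) v $ i" "((*v) T ^^ k) ?w $ i"]
          by (simp add: norm_mult)
        show "(\<lambda>k. cmod (((*v) T ^^ k) ?w $ i)) \<longlonglongrightarrow> 0"
          using tendsto_norm[OF tendsto_vec_nth[OF lim, of i]] by simp
      qed (use True in auto)
      then show ?thesis by (intro vec_tendstoI) simp
    next
      case False
      then have "poly_mat_apply T q v = 0" using ev[of "poly_mat_apply T q v" \<mu>] root by auto
      then show ?thesis using Suc.hyps(1) q by blast
    qed
  qed
  then show ?thesis using annihilating_poly_exists[of T v] by metis
qed

section \<open>Hurwitz matrices and the Lyapunov inequality\<close>

definition cvec :: "real^'n \<Rightarrow> complex^'n" where
  "cvec x = (\<chi> i. complex_of_real (x $ i))"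

lemma cmat_cvec: "cmat M *v cvec x = cvec (M *v x)"
  by (simp add: vec_eq_iff cmat_def cvec_def matrix_vector_mult_def)

lemma cvec_eq_0_iff [simp]: "cvec x = 0 \<longleftrightarrow> x = 0"
  by (simp add: vec_eq_iff cvec_def)

lemma cmat_mult: "cmat (M ** N) = cmat M ** cmat N"
  by (simp add: vec_eq_iff cmat_def matrix_matrix_mult_def)

lemma cmat_add: "cmat (M + N) = cmat M + cmat N"
  by (simp add: vec_eq_iff cmat_def)

lemma cmat_diff: "cmat (M - N) = cmat M - cmat N"
  by (simp add: vec_eq_iff cmat_def)

lemma cmat_mat_1 [simp]: "cmat (mat 1) = mat 1"
  by (simp add: vec_eq_iff cmat_def mat_def)

lemma cvec_tendsto_zeroD:
  assumes "(\<lambda>k. cvec (x k)) \<longlonglongrightarrow> 0"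
  shows "x \<longlonglongrightarrow> 0"
proof (rule vec_tendstoI)
  fix i
  show "(\<lambda>k. x k $ i) \<longlonglongrightarrow> 0 $ i"
    using tendsto_Re[OF tendsto_vec_nth[OF assms, of i]] by (simp add: cvec_def)
qed

lemma sym_mat_inner: "sym_mat D \<Longrightarrow> x \<bullet> (D *v y) = (D *v x) \<bullet> y"
  unfolding sym_mat_def by (metis dot_lmul_matrix transpose_matrix_vector)

lemma matrix_inv_both:
  fixes M :: "'a::field^'n^'n"
  assumes "invertible M"
  shows "M ** matrix_inv M = mat 1" "matrix_inv M ** M = mat 1"
  using assms someI_ex[of "\<lambda>M'. M ** M' = mat 1 \<and> M' ** M = mat 1"]
  by (auto simp: invertible_def matrix_inv_def)

lemma invertible_if_kernel_trivial:
  fixes M :: "'a::field^'n^'n"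
  assumes "\<And>x. M *v x = 0 \<Longrightarrow> x = 0"
  shows "invertible M"
  using assms by (auto simp: invertible_left_inverse matrix_left_invertible_ker)

text \<open>The vector \<open>u = N v\<close> is an eigenvector of \<open>M\<close> for
  \<open>(\<mu> + 1) / (\<mu> - 1)\<close>, whose real part has the sign of
  \<open>|\<mu>|^2 - 1\<close>.\<close>

lemma cayley_eigenvalue:
  assumes M: "hurwitz M" and N: "N ** (M - mat 1) = mat 1" "(M - mat 1) ** N = mat 1"
    and v: "v \<noteq> 0" and ev: "cmat ((M + mat 1) ** N) *v v = \<mu> *s v"
  shows "cmod \<mu> < 1"
proof -
  define u where "u = cmat N *v v"
  have "cmat (M - mat 1) *v u = cmat ((M - mat 1) ** N) *v v"
    by (simp add: u_def cmat_mult matrix_vector_mul_assoc)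
  then have vu: "cmat M *v u - u = v"
    unfolding N(2) by (simp add: cmat_diff matrix_vector_mult_diff_rdistrib)
  have "cmat M *v u + u = \<mu> *s v"
    using ev by (simp add: u_def cmat_mult cmat_add matrix_vector_mul_assoc[symmetric]
        matrix_vector_mult_add_rdistrib)
  then have eq: "cmat M *v u + u = \<mu> *s (cmat M *v u) - \<mu> *s u"
    by (simp add: vu[symmetric] vec.scale_right_diff_distrib)
  have u0: "u \<noteq> 0" using vu v by auto
  have "\<mu> \<noteq> 1"
  proof
    assume "\<mu> = 1"
    then have "u + u = 0" using eq by (simp add: algebra_simps)
    then show False using u0 by (simp add: vec_eq_iff)
  qed
  have "(\<mu> - 1) *s (cmat M *v u) = (\<mu> + 1) *s u"
    using eq by (simp add: vec_eq_iff algebra_simps)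
  then have "cmat M *v u = ((\<mu> + 1) / (\<mu> - 1)) *s u"
    using \<open>\<mu> \<noteq> 1\<close> by (simp add: vec_eq_iff field_simps)
  then have "Re ((\<mu> + 1) / (\<mu> - 1)) < 0" using M u0 by (auto simp: hurwitz_def eigenvalue_def)
  moreover have "Re ((\<mu> + 1) / (\<mu> - 1)) = ((cmod \<mu>)\<^sup>2 - 1) / (cmod (\<mu> - 1))\<^sup>2"
    by (simp add: Re_divide cmod_power2) (simp add: power2_eq_square algebra_simps)
  ultimately have "(cmod \<mu>)\<^sup>2 < 1"
    using \<open>\<mu> \<noteq> 1\<close> by (simp add: divide_less_0_iff)
  then show ?thesis by (simp add: power_less_one_iff abs_square_less_1)
qed

text \<open>The Cayley transform \<open>T = (M + 1) (M - 1)\<inverse>\<close> turns the Lyapunov inequality into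
  the statement that the quadratic form of \<open>D\<close> does not increase along the iterates of \<open>T\<close>,
  which tend to zero.\<close>

lemma lyapunov_nonneg:
  fixes M D :: "real^'n^'n"
  assumes M: "hurwitz M" and D: "sym_mat D" and dec: "\<And>x. (D *v x) \<bullet> (M *v x) \<le> 0"
  shows "0 \<le> x \<bullet> (D *v x)"
proof -
  have "invertible (M - mat 1)"
  proof (rule invertible_if_kernel_trivial)
    fix y assume "(M - mat 1) *v y = 0"
    then have "M *v y = y" by (simp add: matrix_vector_mult_diff_rdistrib)
    then have "cmat M *v cvec y = 1 *s cvec y" by (simp add: cmat_cvec)
    then have "eigenvalue M 1" if "y \<noteq> 0" 
      using that unfolding eigenvalue_def by (intro exI[of _ "cvec y"]) auto
    then show "y = 0" using M unfolding hurwitz_def by (metis not_one_less_zero one_complex.sel(1))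
  qed
  define N where "N = matrix_inv (M - mat 1)"
  note N = matrix_inv_both[OF \<open>invertible (M - mat 1)\<close>, folded N_def]
  define T where "T = (M + mat 1) ** N"
  have iter: "((*v) (cmat T) ^^ k) (cvec x) = cvec (((*v) T ^^ k) x)" for k
    by (induction k) (auto simp: cmat_cvec)
  have "(\<lambda>k. ((*v) (cmat T) ^^ k) (cvec x)) \<longlonglongrightarrow> 0"
    by (rule matrix_iterates_tendsto_zero)
      (use cayley_eigenvalue[OF M N(2,1)] in \<open>auto simp: T_def\<close>)
  then have lim: "(\<lambda>k. ((*v) T ^^ k) x) \<longlonglongrightarrow> 0" by (intro cvec_tendsto_zeroD) (simp add: iter)
  have step: "(T *v y) \<bullet> (D *v (T *v y)) \<le> y \<bullet> (D *v y)" for y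
  proof -
    let ?u = "N *v y"
    \<comment> \<open>Polarisation, for \<open>a = M u\<close> and \<open>b = u\<close> with
      \<open>u = N y\<close>: then \<open>a + b = T y\<close> and \<open>a - b = y\<close>, so one
      step changes the form by four times the Lyapunov expression at \<open>u\<close>.\<close>
    have form: "(a + b) \<bullet> (D *v (a + b)) - (a - b) \<bullet> (D *v (a - b)) = 4 * ((D *v b) \<bullet> a)" for a b
      using sym_mat_inner[OF D, of b a] inner_commute[of a "D *v b"] by (simp add: algebra_simps)
    have y: "y = M *v ?u - ?u"
    proof -
      have "y = ((M - mat 1) ** N) *v y" by (simp add: N)
      then show ?thesis
        by (simp add: matrix_vector_mul_assoc[symmetric] matrix_vector_mult_diff_rdistrib)
    qed
    have Ty: "T *v y = M *v ?u + ?u"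
      by (simp add: T_def matrix_vector_mul_assoc[symmetric] matrix_vector_mult_add_rdistrib)
    have "(T *v y) \<bullet> (D *v (T *v y)) - y \<bullet> (D *v y) = 4 * ((D *v ?u) \<bullet> (M *v ?u))"
      using form[of "M *v ?u" ?u] unfolding Ty y[symmetric] .
    then show ?thesis using dec[of ?u] by simp
  qed
  have "((*v) T ^^ k) x \<bullet> (D *v ((*v) T ^^ k) x) \<le> x \<bullet> (D *v x)" for k
    by (induction k) (auto intro: order_trans[OF step])
  moreover have "(\<lambda>k. ((*v) T ^^ k) x \<bullet> (D *v ((*v) T ^^ k) x)) \<longlonglongrightarrow> 0 \<bullet> (D *v 0)"
    by (intro tendsto_inner lim bounded_linear.tendsto[OF matrix_vector_mul_bounded_linear])
  ultimately show ?thesis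
    using LIMSEQ_le_const2[of _ 0 "x \<bullet> (D *v x)"] by simp
qed

text \<open>Here \<open>a\<close> and \<open>b\<close> are the real and imaginary parts of an
  eigenvector, so that inequalities between real quadratic forms apply to complex eigenvalues. The
  last equation keeps the complex form for the detectability test.\<close>

lemma eigenvalueE:
  assumes "eigenvalue M z"
  obtains a b where "cvec a + \<i> *s cvec b \<noteq> 0"
    "M *v a = Re z *\<^sub>R a - Im z *\<^sub>R b" "M *v b = Im z *\<^sub>R a + Re z *\<^sub>R b"
    "cvec (M *v a) + \<i> *s cvec (M *v b) = z *s (cvec a + \<i> *s cvec b)"
proof -
  obtain v where v: "v \<noteq> 0" "cmat M *v v = z *s v" using assms by (auto simp: eigenvalue_def)
  define a b where "a = (\<chi> i. Re (v $ i))" and "b = (\<chi> i. Im (v $ i))"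
  have vab: "v = cvec a + \<i> *s cvec b"
    by (simp add: vec_eq_iff cvec_def a_def b_def complex_eq)
  have eq: "cvec (M *v a) + \<i> *s cvec (M *v b) = z *s (cvec a + \<i> *s cvec b)"
    using v(2) unfolding vab by (simp add: vec.add vec.scale cmat_cvec)
  then have "(M *v a) $ i = (Re z *\<^sub>R a - Im z *\<^sub>R b) $ i"
    "(M *v b) $ i = (Im z *\<^sub>R a + Re z *\<^sub>R b) $ i" for i
    by (auto simp: vec_eq_iff cvec_def complex_eq_iff dest: spec[of _ i])
  then show ?thesis using that[of a b] v(1) vab eq by (simp add: vec_eq_iff)
qed

section \<open>Positive semidefinite matrices\<close>

lemma inner_transpose_mult: "x \<bullet> (transpose M *v y) = (M *v x) \<bullet> y"
  for M :: "real^'n^'m"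
  by (metis dot_lmul_matrix inner_commute transpose_matrix_vector)

lemma pd_imp_psd: "pd M \<Longrightarrow> psd M"
  unfolding pd_def psd_def by (metis inner_zero_left order_le_less)

lemma pd_invertible: "pd M \<Longrightarrow> invertible M"
  by (rule invertible_if_kernel_trivial) (metis pd_def inner_zero_right order_less_irrefl)

lemma sym_mat_matrix_inv:
  assumes "invertible M" "sym_mat M"
  shows "sym_mat (matrix_inv M)"
proof -
  note inv = matrix_inv_both[OF assms(1)]
  have "transpose (matrix_inv M) ** M = mat 1"
    using inv(1) assms(2) by (metis matrix_transpose_mul sym_mat_def transpose_mat)
  then have "transpose (matrix_inv M) = matrix_inv M"
    by (metis inv(1) matrix_mul_assoc matrix_mul_lid matrix_mul_rid)
  then show ?thesis by (simp add: sym_mat_def)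
qed

lemma transpose_add: "transpose (M + N) = transpose M + transpose N"
  by (simp add: transpose_def vec_eq_iff)

lemma transpose_diff: "transpose (M - N) = transpose M - transpose N"
  by (simp add: transpose_def vec_eq_iff)

lemma transpose_sum: "transpose (\<Sum>i\<in>I. M i) = (\<Sum>i\<in>I. transpose (M i))"
  by (simp add: transpose_def vec_eq_iff)

lemma sum_matrix_vector_mult: "(\<Sum>i\<in>I. M i) *v x = (\<Sum>i\<in>I. M i *v x)"
  by (induction I rule: infinite_finite_induct) (auto simp: matrix_vector_mult_add_rdistrib)

lemma matrix_vector_mult_minus_left: "(- M) *v x = - (M *v x)"
  for M :: "'a::ring_1^'n^'m"
  by (simp add: vec_eq_iff matrix_vector_mult_def sum_negf)

lemma sym_matD: "sym_mat M \<Longrightarrow> transpose M = M"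
  by (simp add: sym_mat_def)

lemma sym_mat_congruence: "sym_mat M \<Longrightarrow> sym_mat (transpose N ** M ** N)"
  by (simp add: sym_mat_def matrix_transpose_mul matrix_mul_assoc)

lemma sym_mat_add: "sym_mat M \<Longrightarrow> sym_mat N \<Longrightarrow> sym_mat (M + N)"
  by (simp add: sym_mat_def transpose_add)

lemma sym_mat_diff: "sym_mat M \<Longrightarrow> sym_mat N \<Longrightarrow> sym_mat (M - N)"
  by (simp add: sym_mat_def transpose_diff)

lemma sym_mat_sum: "(\<And>i. i \<in> I \<Longrightarrow> sym_mat (M i)) \<Longrightarrow> sym_mat (\<Sum>i\<in>I. M i)"
  by (simp add: sym_mat_def transpose_sum)

text \<open>Completing the square in \<open>u\<close>: as \<open>U\<close> is positive definite,
  \<open>K x\<close> is the minimiser and the Schur complement gives the minimum.\<close>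

lemma schur_complement_form:
  fixes S :: "real^'m^'n" and U :: "real^'m^'m"
  assumes U: "pd U"
  defines "K \<equiv> - (matrix_inv U ** transpose S)"
  shows "x \<bullet> (P *v x) + 2 * (x \<bullet> (S *v u)) + u \<bullet> (U *v u)
    = x \<bullet> ((P - S ** matrix_inv U ** transpose S) *v x) + (u - K *v x) \<bullet> (U *v (u - K *v x))"
proof -
  have symU: "sym_mat U" using U by (simp add: pd_def)
  define w where "w = matrix_inv U *v (transpose S *v x)"
  have Kx: "K *v x = - w"
    by (simp only: K_def w_def matrix_vector_mul_assoc matrix_vector_mult_minus_left)
  have Uw: "U *v w = transpose S *v x"
    by (simp only: w_def matrix_vector_mul_assoc[of U] matrix_inv_both[OF pd_invertible[OF U]]
        matrix_vector_mul_lid)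
  have Sw: "(S ** matrix_inv U ** transpose S) *v x = S *v w"
    by (simp only: w_def matrix_vector_mul_assoc matrix_mul_assoc)
  have a: "x \<bullet> (S *v y) = (U *v w) \<bullet> y" for y
    unfolding Uw by (metis inner_commute inner_transpose_mult)
  have b: "w \<bullet> (U *v u) = u \<bullet> (U *v w)" by (metis inner_commute sym_mat_inner[OF symU])
  show ?thesis
    unfolding Kx
    by (simp add: matrix_vector_mult_diff_rdistrib Sw a inner_diff_right inner_add_left
        inner_add_right matrix_vector_right_distrib b inner_commute)
qed

text \<open>If \<open>y = M x\<close> were nonzero, a small step from \<open>x\<close> along
  \<open>-y\<close> would make the form negative.\<close>

lemma psd_kernel:
  assumes M: "psd M" and x: "x \<bullet> (M *v x) = 0"
  shows "M *v x = 0"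
proof (rule ccontr)
  define y where "y = M *v x"
  assume "M *v x \<noteq> 0"
  then have y: "0 < y \<bullet> y" by (simp add: y_def)
  define b where "b = y \<bullet> (M *v y)"
  have b: "0 \<le> b" using M by (simp add: b_def psd_def)
  \<comment> \<open>Any positive \<open>t\<close> with \<open>t * b < 2 * (y \<bullet> y)\<close> is
    small enough; the added 1 guards against \<open>b = 0\<close>.\<close>
  define t where "t = (y \<bullet> y) / (b + 1)"
  have t: "0 < t" "t * (b + 1) = y \<bullet> y" using y b by (simp_all add: t_def)
  have "x \<bullet> (M *v y) = y \<bullet> y"
    using M by (simp add: y_def psd_def sym_mat_inner)
  then have "(x - t *\<^sub>R y) \<bullet> (M *v (x - t *\<^sub>R y)) = t * (t * b - 2 * (y \<bullet> y))"
    using x by (simp add: y_def[symmetric] b_def algebra_simps)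
  then have "0 \<le> t * (t * b - 2 * (y \<bullet> y))" using M by (metis psd_def)
  then have "2 * (y \<bullet> y) \<le> t * b" using t by (simp add: zero_le_mult_iff)
  then show False using t y by (simp add: algebra_simps)
qed

text \<open>On the orthogonal complement of the kernel of \<open>W\<close>, compactness of the unit
  sphere bounds the form from below; \<open>N\<close> vanishes on the kernel, so only the orthogonal
  component of \<open>x\<close> contributes to either side.\<close>

lemma norm_sq_dominated_by_psd_form:
  fixes W :: "real^'n^'n" and N :: "real^'n^'m"
  assumes W: "psd W" and ker: "\<And>x. x \<bullet> (W *v x) = 0 \<Longrightarrow> N *v x = 0"
  obtains \<theta> where "0 \<le> \<theta>" "\<And>x. (N *v x) \<bullet> (N *v x) \<le> \<theta> * (x \<bullet> (W *v x))"
proof -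
  define K where "K = {x. W *v x = 0}"
  have K: "subspace K"
    by (auto simp: K_def subspace_def matrix_vector_right_distrib matrix_vector_mult_scaleR)
  define S where "S = {x. \<forall>y\<in>K. orthogonal y x} \<inter> sphere 0 1"
  have "compact S"
    unfolding S_def
    by (intro closed_Int_compact compact_sphere closed_subspace subspace_orthogonal_to_vectors)
  have "\<exists>\<delta>>0. \<forall>x\<in>S. \<delta> \<le> x \<bullet> (W *v x)"
  proof (cases "S = {}")
    case False
    have "continuous_on S (\<lambda>x. x \<bullet> (W *v x))"
      by (intro continuous_intros linear_continuous_on matrix_vector_mul_bounded_linear)
    from continuous_attains_inf[OF \<open>compact S\<close> False this]
    obtain x where x: "x \<in> S" "\<And>y. y \<in> S \<Longrightarrow> x \<bullet> (W *v x) \<le> y \<bullet> (W *v y)" by auto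
    have "x \<bullet> (W *v x) \<noteq> 0"
    proof
      assume "x \<bullet> (W *v x) = 0"
      then have "x \<in> K" using psd_kernel[OF W] by (simp add: K_def)
      then show False using x(1) by (auto simp: S_def orthogonal_def)
    qed
    then have "0 < x \<bullet> (W *v x)" using W unfolding psd_def by (metis order_le_less)
    then show ?thesis using x(2) by blast
  qed (auto intro: exI[of _ 1])
  then obtain \<delta> where \<delta>: "0 < \<delta>" "\<And>x. x \<in> S \<Longrightarrow> \<delta> \<le> x \<bullet> (W *v x)" by blast
  have perp: "\<delta> * (y \<bullet> y) \<le> y \<bullet> (W *v y)" if y: "\<And>z. z \<in> K \<Longrightarrow> orthogonal z y" for y
  proof (cases "y = 0")
    case False
    have "(1 / norm y) *\<^sub>R y \<in> S"
      using False y by (auto simp: S_def orthogonal_def)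
    from \<delta>(2)[OF this] have "\<delta> \<le> (y \<bullet> (W *v y)) / (norm y * norm y)"
      by (simp add: matrix_vector_mult_scaleR)
    then show ?thesis using False
      by (simp add: field_simps power2_norm_eq_inner[symmetric] power2_eq_square)
  qed simp
  obtain c where c: "0 \<le> c" "\<And>y. norm (N *v y) \<le> norm y * c"
    using bounded_linear.nonneg_bounded[OF matrix_vector_mul_bounded_linear[of N]] by blast
  show ?thesis
  proof
    show "0 \<le> c\<^sup>2 / \<delta>" using \<delta>(1) by simp
    fix x
    obtain y z where yz: "y \<in> span K" "\<And>w. w \<in> span K \<Longrightarrow> orthogonal z w" "x = y + z"
      using orthogonal_subspace_decomp_exists[of K x] by metis
    have y: "W *v y = 0" using yz(1) K by (simp add: span_eq_iff[THEN iffD2] K_def)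
    have "(N *v x) \<bullet> (N *v x) = (norm (N *v z))\<^sup>2"
      using ker[of y] y by (simp add: yz(3) matrix_vector_right_distrib power2_norm_eq_inner)
    also have "\<dots> \<le> (norm z * c)\<^sup>2" using c(2) by (intro power_mono) auto
    also have "\<dots> = c\<^sup>2 / \<delta> * (\<delta> * (z \<bullet> z))"
      using \<delta>(1) by (simp add: power_mult_distrib power2_norm_eq_inner)
    also have "\<dots> \<le> c\<^sup>2 / \<delta> * (z \<bullet> (W *v z))"
      using yz(2) \<delta>(1) by (intro mult_left_mono perp) (auto simp: orthogonal_commute span_base)
    also have "z \<bullet> (W *v z) = x \<bullet> (W *v x)"
    proof -
      have "y \<bullet> (W *v z) = 0"
        using W y by (simp add: psd_def sym_mat_inner)
      then show ?thesis by (simp add: yz(3) y matrix_vector_right_distrib inner_add_left)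
    qed
    finally show "(N *v x) \<bullet> (N *v x) \<le> c\<^sup>2 / \<delta> * (x \<bullet> (W *v x))" .
  qed
qed

section \<open>Limits of matrix sequences\<close>

lemma tendsto_matrix_matrix_mult:
  fixes M :: "'a \<Rightarrow> real^'n^'m" and N :: "'a \<Rightarrow> real^'k^'n"
  assumes "(M \<longlongrightarrow> M') G" "(N \<longlongrightarrow> N') G"
  shows "((\<lambda>k. M k ** N k) \<longlongrightarrow> M' ** N') G"
  unfolding matrix_matrix_mult_def
  by (intro tendsto_vec_lambda tendsto_sum tendsto_mult tendsto_vec_nth assms)

lemma tendsto_matrix_vector_mult:
  fixes M :: "'a \<Rightarrow> real^'n^'m"
  assumes "(M \<longlongrightarrow> M') G" "(x \<longlongrightarrow> x') G"
  shows "((\<lambda>k. M k *v x k) \<longlongrightarrow> M' *v x') G"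
  unfolding matrix_vector_mult_def
  by (intro tendsto_vec_lambda tendsto_sum tendsto_mult tendsto_vec_nth assms)

lemma tendsto_transpose:
  fixes M :: "'a \<Rightarrow> real^'n^'m"
  assumes "(M \<longlongrightarrow> M') G"
  shows "((\<lambda>k. transpose (M k)) \<longlongrightarrow> transpose M') G"
  unfolding transpose_def by (intro tendsto_vec_lambda tendsto_vec_nth assms)

lemma tendsto_quadratic_form:
  fixes M :: "'a \<Rightarrow> real^'n^'n"
  assumes "(M \<longlongrightarrow> M') G"
  shows "((\<lambda>k. x \<bullet> (M k *v x)) \<longlongrightarrow> x \<bullet> (M' *v x)) G"
  by (intro tendsto_inner tendsto_matrix_vector_mult assms tendsto_const)

lemma psd_limit:
  assumes X: "X \<longlonglongrightarrow> Y" and psd: "\<And>k. psd (X k)"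
  shows "psd Y"
proof -
  have "transpose (X k) = X k" for k using psd[of k] by (simp add: psd_def sym_mat_def)
  then have "X \<longlonglongrightarrow> transpose Y" using tendsto_transpose[OF X] by simp
  from LIMSEQ_unique[OF this X] have "sym_mat Y" unfolding sym_mat_def .
  moreover have "0 \<le> x \<bullet> (Y *v x)" for x
    using psd by (intro LIMSEQ_le_const[OF tendsto_quadratic_form[OF X]]) (auto simp: psd_def)
  ultimately show ?thesis by (simp add: psd_def)
qed

text \<open>For each vector the quadratic forms are increasing and bounded, hence convergent;
  polarisation recovers the matrix entries from them.\<close>

lemma loewner_bounded_increasing_convergent:
  fixes X :: "nat \<Rightarrow> real^'n^'n"
  assumes sym: "\<And>k. sym_mat (X k)" and mono: "\<And>k. loewner_le (X k) (X (Suc k))"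
    and bound: "\<And>k. loewner_le (X k) Z"
  shows "convergent X"
proof -
  let ?f = "\<lambda>x k. x \<bullet> (X k *v x)"
  have "convergent (?f x)" for x
  proof -
    have inc: "incseq (?f x)"
    proof (rule incseq_SucI)
      show "?f x k \<le> ?f x (Suc k)" for k
        using mono[of k]
        by (simp add: loewner_le_def psd_def matrix_vector_mult_diff_rdistrib inner_diff_right)
    qed
    have "\<forall>k. ?f x k \<le> x \<bullet> (Z *v x)"
      using bound
      by (simp add: loewner_le_def psd_def matrix_vector_mult_diff_rdistrib inner_diff_right)
    then obtain L where "?f x \<longlonglongrightarrow> L" by (rule incseq_convergent[OF inc])
    then show ?thesis by (rule convergentI)
  qed
  then have l: "?f x \<longlonglongrightarrow> lim (?f x)" for x by (simp only: convergent_LIMSEQ_iff)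
  let ?p = "\<lambda>i j. axis i 1 + axis j (1::real)" and ?m = "\<lambda>i j. axis i 1 - axis j (1::real)"
  have entry: "X k $ i $ j = (?f (?p i j) k - ?f (?m i j) k) / 4" for i j k
  proof -
    have a: "axis i 1 \<bullet> (X k *v axis j 1) = X k $ i $ j" for i j
      by (simp add: inner_axis' matrix_vector_mult_basis column_def)
    have "X k $ j $ i = X k $ i $ j"
      using sym[of k] by (simp add: sym_mat_def transpose_def vec_eq_iff)
    then show ?thesis
      by (simp add: matrix_vector_right_distrib matrix_vector_mult_diff_distrib inner_add_left
          inner_diff_left inner_add_right inner_diff_right a)
  qed
  have "X \<longlonglongrightarrow> (\<chi> i j. (lim (?f (?p i j)) - lim (?f (?m i j))) / 4)"
  proof (intro vec_tendstoI)
    fix i j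
    have "(\<lambda>k. (?f (?p i j) k - ?f (?m i j) k) / 4) \<longlonglongrightarrow> (lim (?f (?p i j)) - lim (?f (?m i j))) / 4"
      by (intro tendsto_intros l) simp
    then show "(\<lambda>k. X k $ i $ j) \<longlonglongrightarrow> (\<chi> i j. (lim (?f (?p i j)) - lim (?f (?m i j))) / 4) $ i $ j"
      by (simp only: entry[symmetric] vec_lambda_beta)
  qed
  then show ?thesis by (rule convergentI)
qed

text \<open>Coercivity uniform in \<open>k\<close> bounds the error by \<open>\<theta>\<close> times
  the residual of the limit solution in the \<open>k\<close>-th system, and this residual tends to
  zero.\<close>

lemma tendsto_matrix_inv_vector_mult:
  fixes U :: "nat \<Rightarrow> real^'m^'m"
  assumes U: "U \<longlonglongrightarrow> U'" and s: "s \<longlonglongrightarrow> s'"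
    and pd: "\<And>k. pd (U k)" "pd U'" and coercive: "\<And>k y. y \<bullet> y \<le> \<theta> * (y \<bullet> (U k *v y))"
    and \<theta>: "0 \<le> \<theta>"
  shows "(\<lambda>k. matrix_inv (U k) *v s k) \<longlonglongrightarrow> matrix_inv U' *v s'"
proof -
  let ?w = "\<lambda>k. matrix_inv (U k) *v s k" and ?w' = "matrix_inv U' *v s'"
  have Uw: "U k *v ?w k = s k" "U' *v ?w' = s'" for k
    by (simp_all add: matrix_vector_mul_assoc matrix_inv_both[OF pd_invertible] pd)
  have "norm (?w k - ?w') \<le> \<theta> * norm (s k - U k *v ?w')" for k
  proof (cases "?w k = ?w'")
    case False
    let ?d = "?w k - ?w'"
    have "norm ?d * norm ?d \<le> \<theta> * (?d \<bullet> (s k - U k *v ?w'))"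
      using coercive[of ?d k]
      by (simp add: matrix_vector_mult_diff_distrib Uw power2_norm_eq_inner[symmetric] power2_eq_square)
    also have "\<dots> \<le> \<theta> * (norm ?d * norm (s k - U k *v ?w'))"
      by (intro mult_left_mono norm_cauchy_schwarz \<theta>)
    finally have "norm ?d * norm ?d \<le> norm ?d * (\<theta> * norm (s k - U k *v ?w'))"
      by (simp add: mult_ac)
    then show ?thesis using False by (simp add: mult_le_cancel_left_pos)
  qed (use \<theta> in simp)
  moreover have "(\<lambda>k. \<theta> * norm (s k - U k *v ?w')) \<longlonglongrightarrow> \<theta> * norm (s' - U' *v ?w')"
    by (intro tendsto_intros s tendsto_matrix_vector_mult U)
  ultimately have "(\<lambda>k. norm (?w k - ?w')) \<longlonglongrightarrow> 0"
    by (intro tendsto_sandwich[of "\<lambda>_. 0" "\<lambda>k. norm (?w k - ?w')" sequentially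
          "\<lambda>k. \<theta> * norm (s k - U k *v ?w')"]) (auto simp: Uw)
  then show ?thesis by (rule LIM_zero_cancel[OF tendsto_norm_zero_cancel])
qed

text \<open>With \<open>U\<close> the inverse of \<open>Rc\<close>, and \<open>Qc\<close>,
  \<open>Lc\<close> in place of \<open>Q\<close>, \<open>L\<close>, this regroups the CARE with
  coefficients \<open>Ac\<close>, \<open>Gc\<close>, \<open>Hc\<close> around a single quadratic
  term.\<close>

lemma care_expand:
  fixes A Q X :: "real^'n^'n" and B L :: "real^'m^'n" and U :: "real^'m^'m"
  assumes U: "sym_mat U" and X: "sym_mat X"
  shows "transpose (A - B ** U ** transpose L) ** X + X ** (A - B ** U ** transpose L)
      - X ** (B ** U ** transpose B) ** X + (Q - L ** U ** transpose L)
    = transpose A ** X + X ** A + Q - (X ** B + L) ** U ** transpose (X ** B + L)"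
  unfolding matrix_eq
  by (simp only: transpose_add transpose_diff matrix_transpose_mul sym_matD[OF U] sym_matD[OF X]
      transpose_transpose matrix_vector_mul_assoc[symmetric] matrix_vector_mult_add_rdistrib
      matrix_vector_mult_diff_rdistrib matrix_vector_right_distrib matrix_vector_mult_diff_distrib)
    simp

section \<open>The generalized Riccati operator\<close>

locale stochastic_riccati =
  fixes A Q :: "real^'n^'n" and B L :: "real^'m^'n" and R :: "real^'m^'m"
    and r :: nat and A0 :: "nat \<Rightarrow> real^'n^'n" and B0 :: "nat \<Rightarrow> real^'m^'n"
    and C :: "real^'n^'p"
  assumes sym_Q: "sym_mat Q" and pd_R: "pd R"
    and C_fac: "transpose C ** C = Q - L ** matrix_inv R ** transpose L"
    and kernel: "\<And>x. (Q - L ** matrix_inv R ** transpose L) *v x = 0 \<Longrightarrow>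
               transpose L *v x = 0 \<and> (\<forall>i\<in>{1..r}. A0 i *v x = 0)"
    and detect: "detectable (Q - L ** matrix_inv R ** transpose L) A"
begin

definition cost :: "real^'n \<Rightarrow> real^'m \<Rightarrow> real" where
  "cost x u = x \<bullet> (Q *v x) + 2 * (x \<bullet> (L *v u)) + u \<bullet> (R *v u)"

text \<open>For \<open>Y = X\<close>, adding this to
  \<open>2 * ((X *v x) \<bullet> (A *v x + B *v u))\<close> gives the generator of
  \<open>x \<bullet> (X *v x)\<close> for the Ito system with drift \<open>A x + B u\<close> and
  noise inputs \<open>A0 i x + B0 i u\<close>.\<close>

definition noise :: "real^'n^'n \<Rightarrow> real^'n \<Rightarrow> real^'m \<Rightarrow> real" where
  "noise Y x u = (\<Sum>i=1..r. (A0 i *v x + B0 i *v u) \<bullet> (Y *v (A0 i *v x + B0 i *v u)))"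

text \<open>Minimising \<open>ham Y X x\<close> over the control gives the quadratic form of \<open>Psi Y X\<close>, attained at
  \<open>gain Y X *v x\<close>. The diagonal \<open>Psi X X\<close> is the Riccati operator, while \<open>Psi (X k)\<close> is the
  left-hand side of the CARE that defines \<open>X (Suc k)\<close>.\<close>

definition ham :: "real^'n^'n \<Rightarrow> real^'n^'n \<Rightarrow> real^'n \<Rightarrow> real^'m \<Rightarrow> real" where
  "ham Y X x u = 2 * ((X *v x) \<bullet> (A *v x + B *v u)) + cost x u + noise Y x u"

definition Psi :: "real^'n^'n \<Rightarrow> real^'n^'n \<Rightarrow> real^'n^'n" where
  "Psi Y X = transpose A ** X + X ** A + Qc Q r A0 Y
     - (X ** B + Lc L r A0 B0 Y) ** matrix_inv (Rc R r B0 Y) ** transpose (X ** B + Lc L r A0 B0 Y)"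

definition gain :: "real^'n^'n \<Rightarrow> real^'n^'n \<Rightarrow> real^'n^'m" where
  "gain Y X = - (matrix_inv (Rc R r B0 Y) ** transpose (X ** B + Lc L r A0 B0 Y))"

lemma sym_R: "sym_mat R"
  using pd_R by (simp add: pd_def)

text \<open>The Schur complement of \<open>R\<close> in the cost is the Gram matrix of
  \<open>C\<close>, so completing the square leaves two nonnegative terms, which vanish separately
  when the cost is zero.\<close>

lemma cost_eq:
  "cost x u = (C *v x) \<bullet> (C *v x)
    + (u + matrix_inv R *v (transpose L *v x)) \<bullet> (R *v (u + matrix_inv R *v (transpose L *v x)))"
proof -
  have "(C *v x) \<bullet> (C *v x) = x \<bullet> ((Q - L ** matrix_inv R ** transpose L) *v x)"
    by (simp only: C_fac[symmetric] matrix_vector_mul_assoc[symmetric] inner_transpose_mult)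
  then show ?thesis
    unfolding cost_def
    by (subst schur_complement_form[OF pd_R])
      (simp only: matrix_vector_mult_minus_left matrix_vector_mul_assoc diff_minus_eq_add)
qed

lemma cost_nonneg: "0 \<le> cost x u"
  using pd_imp_psd[OF pd_R] unfolding cost_eq by (simp add: psd_def)

text \<open>Both squares vanish. \<open>C x = 0\<close> puts \<open>x\<close> into the kernel of the
  Schur complement, where the kernel hypothesis removes \<open>transpose L\<close> and every
  \<open>A0 i\<close>; the other square then yields \<open>u = 0\<close>.\<close>

lemma cost_eq_0D:
  assumes "cost x u = 0"
  shows "(Q - L ** matrix_inv R ** transpose L) *v x = 0" "u = 0"
    "\<And>i. i \<in> {1..r} \<Longrightarrow> A0 i *v x = 0"
proof -
  let ?w = "u + matrix_inv R *v (transpose L *v x)"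
  have "0 \<le> ?w \<bullet> (R *v ?w)" using pd_imp_psd[OF pd_R] by (simp only: psd_def)
  then have C: "(C *v x) \<bullet> (C *v x) = 0" and w: "?w \<bullet> (R *v ?w) = 0"
    using assms inner_ge_zero[of "C *v x"] unfolding cost_eq by linarith+
  show W0: "(Q - L ** matrix_inv R ** transpose L) *v x = 0"
    using C by (simp add: C_fac[symmetric] matrix_vector_mul_assoc[symmetric] del: transpose_matrix_vector)
  have "?w = 0" using w pd_R unfolding pd_def by (metis order_less_irrefl)
  then show "u = 0" using kernel[OF W0] by simp
  show "A0 i *v x = 0" if "i \<in> {1..r}" for i using kernel[OF W0] that by blast
qed

lemma noise_nonneg: "psd Y \<Longrightarrow> 0 \<le> noise Y x u"
  by (auto simp: noise_def psd_def intro: sum_nonneg)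

lemma noise_diff: "noise (Y - Y') x u = noise Y x u - noise Y' x u"
  by (simp add: noise_def sum_subtractf[symmetric] matrix_vector_mult_diff_rdistrib inner_diff_right)

lemma sym_Rc: "sym_mat Y \<Longrightarrow> sym_mat (Rc R r B0 Y)"
  unfolding Rc_def Pi22_def by (intro sym_mat_add sym_R sym_mat_sum sym_mat_congruence)

lemma Rc_form: "u \<bullet> (Rc R r B0 Y *v u) = u \<bullet> (R *v u) + noise Y 0 u"
  by (simp add: Rc_def Pi22_def noise_def matrix_vector_mult_add_rdistrib inner_add_right
      sum_matrix_vector_mult inner_sum_right matrix_vector_mul_assoc[symmetric] inner_transpose_mult
      del: transpose_matrix_vector)

lemma pd_Rc: "psd Y \<Longrightarrow> pd (Rc R r B0 Y)"
  using pd_R sym_Rc[of Y] noise_nonneg[of Y 0] unfolding pd_def psd_def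
  by (metis Rc_form add_pos_nonneg)

lemma ham_eq:
  assumes Y: "psd Y" and X: "sym_mat X"
  shows "ham Y X x u = x \<bullet> (Psi Y X *v x)
    + (u - gain Y X *v x) \<bullet> (Rc R r B0 Y *v (u - gain Y X *v x))"
proof -
  have symY: "sym_mat Y" using Y by (simp add: psd_def)
  let ?P = "transpose A ** X + X ** A + Qc Q r A0 Y" and ?S = "X ** B + Lc L r A0 B0 Y"
  have "ham Y X x u = x \<bullet> (?P *v x) + 2 * (x \<bullet> (?S *v u)) + u \<bullet> (Rc R r B0 Y *v u)"
  proof -
    have P: "x \<bullet> (?P *v x) = 2 * ((X *v x) \<bullet> (A *v x)) + x \<bullet> (Q *v x) + noise Y x 0"
      by (simp add: Qc_def Pi11_def noise_def matrix_vector_mult_add_rdistrib inner_add_right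
          sum_matrix_vector_mult inner_sum_right matrix_vector_mul_assoc[symmetric] inner_transpose_mult
          sym_mat_inner[OF X, of x] inner_commute[of "A *v x"]
        del: transpose_matrix_vector)
    have S: "x \<bullet> (?S *v u) = (X *v x) \<bullet> (B *v u) + x \<bullet> (L *v u)
        + (\<Sum>i=1..r. (A0 i *v x) \<bullet> (Y *v (B0 i *v u)))"
      by (simp add: Lc_def Pi12_def matrix_vector_mult_add_rdistrib inner_add_right
          sum_matrix_vector_mult inner_sum_right matrix_vector_mul_assoc[symmetric] inner_transpose_mult
          sym_mat_inner[OF X]
        del: transpose_matrix_vector)
    have "noise Y x u = noise Y x 0 + 2 * (\<Sum>i=1..r. (A0 i *v x) \<bullet> (Y *v (B0 i *v u))) + noise Y 0 u"
    proof -
      have "(B0 i *v u) \<bullet> (Y *v (A0 i *v x)) = (A0 i *v x) \<bullet> (Y *v (B0 i *v u))" for i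
        by (metis inner_commute sym_mat_inner[OF symY])
      then show ?thesis
        by (simp add: noise_def sum.distrib[symmetric] sum_distrib_left matrix_vector_right_distrib
            inner_add_left inner_add_right add_ac)
    qed
    then show ?thesis
      unfolding P S Rc_form ham_def cost_def by (simp add: inner_add_right)
  qed
  then show ?thesis
    unfolding Psi_def gain_def by (simp only: schur_complement_form[OF pd_Rc[OF Y]])
qed

lemma ham_gain:
  assumes "psd Y" "sym_mat X"
  shows "ham Y X x (gain Y X *v x) = x \<bullet> (Psi Y X *v x)"
  by (simp add: ham_eq[OF assms])

lemma Psi_le_ham:
  assumes "psd Y" "sym_mat X"
  shows "x \<bullet> (Psi Y X *v x) \<le> ham Y X x u"
  using pd_imp_psd[OF pd_Rc[OF assms(1)]] by (simp add: ham_eq[OF assms] psd_def)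

section \<open>Stability of closed loops and comparison of solutions\<close>

text \<open>On an eigenvector with \<open>Re z \<ge> 0\<close> the Lyapunov term is nonnegative, so
  a nonpositive Hamiltonian leaves no room for positive cost. Zero cost switches the feedback off,
  and the vector becomes an undetectable mode of \<open>A\<close>.\<close>

lemma closed_loop_hurwitz:
  assumes Y: "psd Y" and X: "psd X" and le: "\<And>x. x \<bullet> (Psi Y X *v x) \<le> 0"
  shows "hurwitz (A + B ** gain Y X)"
  unfolding hurwitz_def
proof (intro allI impI, rule ccontr)
  let ?F = "gain Y X"
  let ?M = "A + B ** ?F"
  fix z assume "eigenvalue ?M z" and "\<not> Re z < 0"
  have symX: "sym_mat X" using X by (simp add: psd_def)
  from \<open>eigenvalue ?M z\<close> obtain a b where ab: "cvec a + \<i> *s cvec b \<noteq> 0"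
    "?M *v a = Re z *\<^sub>R a - Im z *\<^sub>R b" "?M *v b = Im z *\<^sub>R a + Re z *\<^sub>R b"
    "cvec (?M *v a) + \<i> *s cvec (?M *v b) = z *s (cvec a + \<i> *s cvec b)"
    by (rule eigenvalueE)
  have M: "?M *v x = A *v x + B *v (?F *v x)" for x
    by (simp add: matrix_vector_mult_add_rdistrib matrix_vector_mul_assoc)
  have *: "2 * ((X *v x) \<bullet> (?M *v x)) + cost x (?F *v x) \<le> 0" for x
    using le[of x] noise_nonneg[OF Y, of x "?F *v x"]
    unfolding ham_gain[OF Y symX, symmetric] ham_def M by linarith
  \<comment> \<open>Adding the contributions of \<open>a\<close> and \<open>b\<close> cancels the
    terms with \<open>Im z\<close>, by symmetry of \<open>X\<close>.\<close>
  have "(X *v a) \<bullet> (?M *v a) + (X *v b) \<bullet> (?M *v b)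
      = Re z * (a \<bullet> (X *v a) + b \<bullet> (X *v b))"
  proof -
    have "(X *v a) \<bullet> b = (X *v b) \<bullet> a" by (metis inner_commute sym_mat_inner[OF symX])
    then show ?thesis
      unfolding ab(2,3) by (simp add: inner_commute algebra_simps)
  qed
  moreover have "0 \<le> Re z * (a \<bullet> (X *v a) + b \<bullet> (X *v b))"
    using \<open>\<not> Re z < 0\<close> X by (simp add: psd_def)
  ultimately have c: "cost a (?F *v a) = 0" "cost b (?F *v b) = 0"
    using *[of a] *[of b] cost_nonneg[of a "?F *v a"] cost_nonneg[of b "?F *v b"] by linarith+
  let ?W = "Q - L ** matrix_inv R ** transpose L" and ?v = "cvec a + \<i> *s cvec b"
  have "?M *v a = A *v a" "?M *v b = A *v b"
    using cost_eq_0D(2)[OF c(1)] cost_eq_0D(2)[OF c(2)] by (simp_all add: M)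
  then have "cmat A *v ?v = z *s ?v"
    using ab(4) by (simp add: vec.add vec.scale cmat_cvec)
  moreover have "cmat ?W *v ?v = cvec (?W *v a) + \<i> *s cvec (?W *v b)"
    by (simp only: vec.add vec.scale cmat_cvec)
  then have "cmat ?W *v ?v = 0"
    by (simp only: cost_eq_0D(1)[OF c(1)] cost_eq_0D(1)[OF c(2)]) (simp add: cvec_def vec_eq_iff)
  ultimately show False
    using detect \<open>\<not> Re z < 0\<close> ab(1) unfolding detectable_def by (meson not_less)
qed

lemma ham_diff: "ham Y X1 x u - ham Y X2 x u = 2 * (((X1 - X2) *v x) \<bullet> (A *v x + B *v u))"
  by (simp add: ham_def matrix_vector_mult_diff_rdistrib inner_diff_left)

text \<open>At the feedback optimal for \<open>X1\<close> the Hamiltonian of \<open>X1\<close> is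
  nonpositive and that of \<open>X2\<close> nonnegative; in their difference cost and noise cancel,
  leaving the Lyapunov expression for \<open>X1 - X2\<close>.\<close>

lemma Psi_comparison:
  assumes Y: "psd Y" and X1: "sym_mat X1" and X2: "sym_mat X2"
    and stable: "hurwitz (A + B ** gain Y X1)"
    and le: "\<And>x. x \<bullet> (Psi Y X1 *v x) \<le> 0" and ge: "\<And>x. 0 \<le> x \<bullet> (Psi Y X2 *v x)"
  shows "loewner_le X2 X1"
proof -
  have "((X1 - X2) *v x) \<bullet> ((A + B ** gain Y X1) *v x) \<le> 0" for x
    using ham_diff[of Y X1 x "gain Y X1 *v x" X2] ham_gain[OF Y X1, of x] le[of x] ge[of x]
      Psi_le_ham[OF Y X2, of x "gain Y X1 *v x"]
    by (simp add: matrix_vector_mult_add_rdistrib matrix_vector_mul_assoc)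
  then have "0 \<le> x \<bullet> ((X1 - X2) *v x)" for x
    by (intro lyapunov_nonneg[OF stable] sym_mat_diff X1 X2)
  then show ?thesis by (simp add: loewner_le_def psd_def sym_mat_diff X1 X2)
qed

text \<open>At the control optimal for the larger \<open>Y'\<close>, the two Hamiltonians differ by
  the nonnegative noise of \<open>Y' - Y\<close>, and minimising for \<open>Y\<close> only lowers
  its value.\<close>

lemma Psi_mono:
  assumes Y: "psd Y" "psd Y'" "loewner_le Y Y'" and X: "sym_mat X"
  shows "x \<bullet> (Psi Y X *v x) \<le> x \<bullet> (Psi Y' X *v x)"
proof -
  let ?u = "gain Y' X *v x"
  have "x \<bullet> (Psi Y X *v x) \<le> ham Y X x ?u" by (rule Psi_le_ham[OF Y(1) X])
  also have "\<dots> \<le> ham Y' X x ?u"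
    using noise_nonneg[of "Y' - Y" x ?u] Y(3) by (simp add: ham_def noise_diff loewner_le_def)
  also have "\<dots> = x \<bullet> (Psi Y' X *v x)" by (rule ham_gain[OF Y(2) X])
  finally show ?thesis .
qed

section \<open>Uniqueness of the positive semidefinite solution\<close>

text \<open>Zero cost forces zero control and zero noise inputs, so the squared norm of each input
  is bounded by a multiple of the closed-loop cost; a norm bound for \<open>P\<close> and a sum over
  \<open>i\<close> give one constant.\<close>

lemma noise_dominated_by_cost:
  "\<exists>\<kappa>\<ge>0. \<forall>x. noise P x (F *v x) \<le> \<kappa> * cost x (F *v x)"
proof -
  \<comment> \<open>The matrix of the closed-loop cost, with the mixed term symmetrised.\<close>
  define W where "W = Q + (L ** F + transpose (L ** F)) + transpose F ** R ** F"
  have W: "x \<bullet> (W *v x) = cost x (F *v x)" for x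
    by (simp add: W_def cost_def matrix_vector_mult_add_rdistrib inner_add_right inner_transpose_mult
        matrix_vector_mul_assoc[symmetric] inner_commute[of "L *v (F *v x)"]
      del: transpose_matrix_vector)
  have "sym_mat (L ** F + transpose (L ** F))"
    by (simp add: sym_mat_def transpose_add add.commute)
  then have "sym_mat W"
    unfolding W_def by (rule sym_mat_add[OF sym_mat_add[OF sym_Q] sym_mat_congruence[OF sym_R]])
  then have "psd W" by (simp add: psd_def W cost_nonneg)
  have "\<exists>\<theta>\<ge>0. \<forall>x. ((A0 i + B0 i ** F) *v x) \<bullet> ((A0 i + B0 i ** F) *v x) \<le> \<theta> * cost x (F *v x)"
    if "i \<in> {1..r}" for i
  proof (rule norm_sq_dominated_by_psd_form[OF \<open>psd W\<close>, of "A0 i + B0 i ** F"])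
    show "(A0 i + B0 i ** F) *v x = 0" if "x \<bullet> (W *v x) = 0" for x
      using cost_eq_0D[OF that[unfolded W]] \<open>i \<in> {1..r}\<close>
      by (simp add: matrix_vector_mult_add_rdistrib matrix_vector_mul_assoc[symmetric])
  qed (auto simp: W)
  then obtain \<theta> where \<theta>: "\<And>i. i \<in> {1..r} \<Longrightarrow> 0 \<le> \<theta> i"
    "\<And>i x. i \<in> {1..r} \<Longrightarrow> ((A0 i + B0 i ** F) *v x) \<bullet> ((A0 i + B0 i ** F) *v x) \<le> \<theta> i * cost x (F *v x)"
    by metis
  obtain c where c: "0 \<le> c" "\<And>y. norm (P *v y) \<le> norm y * c"
    using bounded_linear.nonneg_bounded[OF matrix_vector_mul_bounded_linear[of P]] by blast
  have P: "y \<bullet> (P *v y) \<le> c * (y \<bullet> y)" for y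
  proof -
    have "y \<bullet> (P *v y) \<le> norm y * norm (P *v y)" by (rule norm_cauchy_schwarz)
    also have "\<dots> \<le> norm y * (norm y * c)" using c(2) by (intro mult_left_mono) auto
    finally show ?thesis by (simp add: power2_norm_eq_inner[symmetric] power2_eq_square mult_ac)
  qed
  show ?thesis
  proof (intro exI conjI allI)
    show "0 \<le> (\<Sum>i=1..r. c * \<theta> i)" using c(1) \<theta>(1) by (intro sum_nonneg) auto
    fix x
    have "noise P x (F *v x) = (\<Sum>i=1..r. ((A0 i + B0 i ** F) *v x) \<bullet> (P *v ((A0 i + B0 i ** F) *v x)))"
      by (simp add: noise_def matrix_vector_mult_add_rdistrib matrix_vector_mul_assoc[symmetric])
    also have "\<dots> \<le> (\<Sum>i=1..r. c * (\<theta> i * cost x (F *v x)))"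
      using \<theta>(2) c(1) by (intro sum_mono order_trans[OF P] mult_left_mono) auto
    also have "\<dots> = (\<Sum>i=1..r. c * \<theta> i) * cost x (F *v x)"
      by (simp add: sum_distrib_right mult.assoc)
    finally show "noise P x (F *v x) \<le> (\<Sum>i=1..r. c * \<theta> i) * cost x (F *v x)" .
  qed
qed

lemma noise_scaleR: "noise (c *\<^sub>R Y) x u = c * noise Y x u"
  by (simp add: noise_def sum_distrib_left scaleR_matrix_vector_assoc[symmetric])

text \<open>Since \<open>cost\<close> controls the noise terms along the closed loop, the Lyapunov inequality improves
  \<open>Z - Y \<preceq> \<kappa> Y\<close> to \<open>Z - Y \<preceq> \<kappa> q Y\<close> with a fixed \<open>q < 1\<close>.\<close>

lemma psd_solution_unique:
  assumes Y: "psd Y" and Z: "psd Z" and YZ: "loewner_le Y Z"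
    and le: "\<And>x. x \<bullet> (Psi Y Y *v x) \<le> 0" and ge: "\<And>x. 0 \<le> x \<bullet> (Psi Z Z *v x)"
  shows "Y = Z"
proof -
  define D where "D = Z - Y"
  define F where "F = gain Y Y"
  let ?M = "A + B ** F"
  let ?c = "\<lambda>x. cost x (F *v x)" and ?n = "\<lambda>P x. noise P x (F *v x)"
  have D: "psd D" using YZ by (simp add: D_def loewner_le_def)
  have sym: "sym_mat Y" "sym_mat Z" "sym_mat D" using Y Z D by (auto simp: psd_def)
  have stable: "hurwitz ?M" unfolding F_def by (rule closed_loop_hurwitz[OF Y Y le])
  have M: "?M *v x = A *v x + B *v (F *v x)" for x
    by (simp add: matrix_vector_mult_add_rdistrib matrix_vector_mul_assoc)
  have hY: "2 * ((Y *v x) \<bullet> (?M *v x)) + ?c x + ?n Y x \<le> 0" for x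
    using le[of x] ham_gain[OF Y sym(1), of x] by (simp add: ham_def F_def[symmetric] M)
  \<comment> \<open>The feedback of \<open>Y\<close> is suboptimal for \<open>Z\<close>, so the
    Hamiltonian of \<open>Z\<close> is nonnegative there; \<open>hY\<close> is then
    subtracted.\<close>
  have hD: "0 \<le> 2 * ((D *v x) \<bullet> (?M *v x)) + ?n D x" for x
  proof -
    have "0 \<le> ham Z Z x (F *v x)" using ge[of x] Psi_le_ham[OF Z sym(2)] order_trans by blast
    then show ?thesis
      using hY[of x] by (simp add: ham_def D_def noise_diff matrix_vector_mult_diff_rdistrib inner_diff_left M)
  qed
  \<comment> \<open>Subtracting \<open>hD\<close> from \<open>\<kappa>\<close> times
    \<open>hY\<close> gives the Lyapunov inequality for \<open>\<kappa> Y - D\<close>, once the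
    premise absorbs the noise of \<open>D\<close>.\<close>
  have lyap: "psd (\<kappa> *\<^sub>R Y - D)"
    if "\<And>x. ?n D x \<le> \<kappa> * (?c x + ?n Y x)" and "0 \<le> \<kappa>" for \<kappa>
  proof -
    have s: "sym_mat (\<kappa> *\<^sub>R Y - D)"
      using sym by (simp add: sym_mat_def transpose_diff transpose_scalar)
    have "((\<kappa> *\<^sub>R Y - D) *v x) \<bullet> (?M *v x) \<le> 0" for x
    proof -
      have "\<kappa> * (2 * ((Y *v x) \<bullet> (?M *v x)) + ?c x + ?n Y x) \<le> 0"
        using hY[of x] \<open>0 \<le> \<kappa>\<close> by (rule mult_nonneg_nonpos[rotated])
      then show ?thesis
        using hD[of x] that(1)[of x]
        by (simp add: scaleR_matrix_vector_assoc[symmetric] algebra_simps)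
    qed
    then show ?thesis using lyapunov_nonneg[OF stable s] s by (simp add: psd_def)
  qed
  obtain \<kappa> where \<kappa>: "0 \<le> \<kappa>" "\<And>x. ?n D x \<le> \<kappa> * ?c x"
    using noise_dominated_by_cost[of D F] by blast
  obtain \<theta> where \<theta>: "0 \<le> \<theta>" "\<And>x. ?n Y x \<le> \<theta> * ?c x"
    using noise_dominated_by_cost[of Y F] by blast
  \<comment> \<open>From \<open>n \<le> \<theta> * c\<close> follows
    \<open>(1 + \<theta>) * n \<le> \<theta> * (c + n)\<close>, hence this ratio.\<close>
  define q where "q = \<theta> / (1 + \<theta>)"
  have q: "0 \<le> q" "q < 1" using \<theta>(1) by (simp_all add: q_def)
  have contraction: "?n Y x \<le> q * (?c x + ?n Y x)" for x
    using \<theta> by (simp add: q_def field_simps)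
  have geometric: "psd ((\<kappa> * q ^ j) *\<^sub>R Y - D)" for j
  proof (induction j)
    case 0
    show ?case
    proof (rule lyap)
      show "?n D x \<le> \<kappa> * q ^ 0 * (?c x + ?n Y x)" for x
        using \<kappa>(2)[of x] mult_nonneg_nonneg[OF \<kappa>(1) noise_nonneg[OF Y, of x "F *v x"]]
        by (simp add: algebra_simps)
    qed (use \<kappa> in simp)
  next
    case (Suc j)
    show ?case
    proof (rule lyap)
      fix x
      \<comment> \<open>The induction hypothesis, evaluated on the noise inputs, bounds the noise of
        \<open>D\<close> by that of \<open>Y\<close>; \<open>contraction\<close> then gains the
        factor \<open>q\<close>.\<close>
      have "?n D x \<le> \<kappa> * q ^ j * ?n Y x"
        using noise_nonneg[OF Suc, of x "F *v x"] by (simp add: noise_diff noise_scaleR)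
      also have "\<dots> \<le> \<kappa> * q ^ j * (q * (?c x + ?n Y x))"
        using \<kappa> q contraction by (intro mult_left_mono) auto
      finally show "?n D x \<le> \<kappa> * q ^ Suc j * (?c x + ?n Y x)" by (simp add: mult_ac)
    qed (use \<kappa> q in simp)
  qed
  have "D *v x = 0" for x
  proof (rule psd_kernel[OF D], rule antisym)
    have "x \<bullet> (D *v x) \<le> \<kappa> * q ^ j * (x \<bullet> (Y *v x))" for j
      using geometric[of j]
      by (simp add: psd_def matrix_vector_mult_diff_rdistrib inner_diff_right
          scaleR_matrix_vector_assoc[symmetric])
    moreover have "(\<lambda>j. \<kappa> * q ^ j * (x \<bullet> (Y *v x))) \<longlonglongrightarrow> \<kappa> * 0 * (x \<bullet> (Y *v x))"
      using q by (intro tendsto_intros LIMSEQ_power_zero) auto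
    ultimately show "x \<bullet> (D *v x) \<le> 0"
      using LIMSEQ_le_const[of _ _ "x \<bullet> (D *v x)"] by fastforce
    show "0 \<le> x \<bullet> (D *v x)" using D by (simp add: psd_def)
  qed
  then have "D = 0" by (simp add: matrix_eq)
  then show ?thesis by (simp add: D_def)
qed

section \<open>Translation between the CARE and \<open>Psi\<close>\<close>

lemma riccati_eq_Psi: "riccati A B Q L R r A0 B0 X = Psi X X"
  by (simp add: riccati_def Psi_def Qc_def Lc_def Rc_def add.assoc)

lemma sym_inv_Rc: "psd Y \<Longrightarrow> sym_mat (matrix_inv (Rc R r B0 Y))"
  by (intro sym_mat_matrix_inv pd_invertible pd_Rc sym_Rc) (auto simp: psd_def)

lemma care_eq_Psi:
  assumes "psd Y" "sym_mat X"
  shows "transpose (Ac A B L R r A0 B0 Y) ** X + X ** Ac A B L R r A0 B0 Y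
     - X ** Gc B R r B0 Y ** X + Hc Q L R r A0 B0 Y = Psi Y X"
  unfolding Ac_def Gc_def Hc_def Psi_def by (rule care_expand[OF sym_inv_Rc[OF assms(1)] assms(2)])

text \<open>This carries the stabilizing property of a CARE solution over to the closed loops in
  \<open>closed_loop_hurwitz\<close> and \<open>Psi_comparison\<close>.\<close>

lemma Ac_diff_Gc:
  assumes "psd Y" "sym_mat X"
  shows "Ac A B L R r A0 B0 Y - Gc B R r B0 Y ** X = A + B ** gain Y X"
  unfolding matrix_eq
  by (simp add: Ac_def Gc_def gain_def transpose_add matrix_transpose_mul sym_matD[OF assms(2)]
      matrix_vector_mul_assoc[symmetric] matrix_vector_mult_minus_left vec.neg algebra_simps
    del: transpose_matrix_vector)

lemma sym_Psi:
  assumes "psd Y" "sym_mat X"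
  shows "sym_mat (Psi Y X)"
proof -
  have Y: "sym_mat Y" using assms(1) by (simp add: psd_def)
  have AX: "sym_mat (transpose A ** X + X ** A)"
    using sym_matD[OF assms(2)] by (simp add: sym_mat_def transpose_add matrix_transpose_mul add.commute)
  have Q: "sym_mat (Qc Q r A0 Y)"
    unfolding Qc_def Pi11_def by (intro sym_mat_add sym_Q sym_mat_sum sym_mat_congruence Y)
  show ?thesis
    using sym_mat_diff[OF sym_mat_add[OF AX Q] sym_mat_congruence[OF sym_inv_Rc[OF assms(1)],
        of "transpose (X ** B + Lc L r A0 B0 Y)"]]
    by (simp add: Psi_def)
qed

text \<open>The inverse is the delicate term. Noise only adds to \<open>R\<close>, so the coercivity
  constant of \<open>R\<close> serves every \<open>Rc R r B0 (Y k)\<close>.\<close>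

lemma Psi_form_tendsto:
  assumes Y: "Y \<longlonglongrightarrow> Y'" and X: "X \<longlonglongrightarrow> X'" and psd: "\<And>k. psd (Y k)"
  shows "(\<lambda>k. x \<bullet> (Psi (Y k) (X k) *v x)) \<longlonglongrightarrow> x \<bullet> (Psi Y' X' *v x)"
proof -
  note lims = tendsto_matrix_matrix_mult tendsto_add tendsto_diff tendsto_sum tendsto_const Y X
    tendsto_transpose
  have psd': "psd Y'" by (rule psd_limit[OF Y psd])
  have Rc: "(\<lambda>k. Rc R r B0 (Y k)) \<longlonglongrightarrow> Rc R r B0 Y'"
    unfolding Rc_def Pi22_def by (intro lims)
  have S: "(\<lambda>k. X k ** B + Lc L r A0 B0 (Y k)) \<longlonglongrightarrow> X' ** B + Lc L r A0 B0 Y'"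
    unfolding Lc_def Pi12_def by (intro lims)
  have P: "(\<lambda>k. transpose A ** X k + X k ** A + Qc Q r A0 (Y k))
      \<longlonglongrightarrow> transpose A ** X' + X' ** A + Qc Q r A0 Y'"
    unfolding Qc_def Pi11_def by (intro lims)
  obtain \<theta> where \<theta>: "0 \<le> \<theta>" "\<And>y. y \<bullet> y \<le> \<theta> * (y \<bullet> (R *v y))"
  proof (rule norm_sq_dominated_by_psd_form[OF pd_imp_psd[OF pd_R], of "mat 1 :: real^'m^'m"])
    show "mat 1 *v x = 0" if "x \<bullet> (R *v x) = 0" for x
      using pd_R that unfolding pd_def by (metis matrix_vector_mul_lid order_less_irrefl)
  qed auto
  have coercive: "y \<bullet> y \<le> \<theta> * (y \<bullet> (Rc R r B0 (Y k) *v y))" for k y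
    using \<theta>(2)[of y] mult_nonneg_nonneg[OF \<theta>(1) noise_nonneg[OF psd[of k], of 0 y]]
    by (simp add: Rc_form distrib_left)
  note w = tendsto_matrix_inv_vector_mult[OF Rc
      tendsto_matrix_vector_mult[OF tendsto_transpose[OF S] tendsto_const[of x]]
      pd_Rc[OF psd] pd_Rc[OF psd'] coercive \<theta>(1)]
  show ?thesis
    unfolding Psi_def matrix_vector_mult_diff_rdistrib matrix_vector_mul_assoc[symmetric]
    by (intro tendsto_inner tendsto_const tendsto_diff tendsto_matrix_vector_mult[OF P]
        tendsto_matrix_vector_mult[OF S] w)
qed

end

section \<open>The iteration and its limit\<close>

theorem theorem3p3:
  fixes A Q :: "real^'n^'n" and B L :: "real^'m^'n" and R :: "real^'m^'m"
    and r :: nat and A0 :: "nat \<Rightarrow> real^'n^'n" and B0 :: "nat \<Rightarrow> real^'m^'n"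
    and C :: "real^'n^'p"
    and Xs :: "real^'n^'n" and X :: "nat \<Rightarrow> real^'n^'n"
  assumes sym_Q: "sym_mat Q" and sym_R: "sym_mat R"
    and A1_R: "pd R"
    and A1_blk: "psd (block_mat Q L (transpose L) R)"
    and A2: "\<exists>F :: real^'n^'m. exp_stable (\<lambda>S. (A + B ** F) ** S + S ** transpose (A + B ** F)
               + (\<Sum>i=1..r. (A0 i + B0 i ** F) ** S ** transpose (A0 i + B0 i ** F)))"
    and C_fac: "transpose C ** C = Q - L ** matrix_inv R ** transpose L"
    and A3: "\<exists>K :: real^'p^'n.
               exp_stable (\<lambda>S. (A - B ** matrix_inv R ** transpose L + K ** C) ** S
                  + S ** transpose (A - B ** matrix_inv R ** transpose L + K ** C)
                  + (\<Sum>i=1..r. (A0 i - B0 i ** matrix_inv R ** transpose L) ** S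
                                ** transpose (A0 i - B0 i ** matrix_inv R ** transpose L)))"
    and A4: "\<forall>x. (Q - L ** matrix_inv R ** transpose L) *v x = 0 \<longrightarrow>
               transpose L *v x = 0 \<and> (\<forall>i\<in>{1..r}. A0 i *v x = 0)"
    and A5_stab: "stabilizable A B"
    and A5_det: "detectable (Q - L ** matrix_inv R ** transpose L) A"
    and Xs_psd: "psd Xs"
    and Xs_sol: "riccati A B Q L R r A0 B0 Xs = 0"
    and X0: "X 0 = 0"
    and X_step: "\<forall>k. stabilizing_care_sol (Ac A B L R r A0 B0 (X k)) (Gc B R r B0 (X k))
                                          (Hc Q L R r A0 B0 (X k)) (X (Suc k))"
  shows "(\<forall>k. loewner_le (X k) (X (Suc k)) \<and> loewner_le (X k) Xs
              \<and> psd (riccati A B Q L R r A0 B0 (X k))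
              \<and> hurwitz (Ac A B L R r A0 B0 (X k) - Gc B R r B0 (X k) ** Xs))
         \<and> (X \<longlonglongrightarrow> Xs) \<and> psd Xs
         \<and> (\<forall>z. eigenvalue (Ac A B L R r A0 B0 Xs - Gc B R r B0 Xs ** Xs) z \<longrightarrow> Re z \<le> 0)"
proof -
  interpret stochastic_riccati A Q B L R r A0 B0 C
    by unfold_locales (use sym_Q A1_R C_fac A4 A5_det in blast)+
  have symXs: "sym_mat Xs" using Xs_psd by (simp add: psd_def)
  have Psi_Xs: "Psi Xs Xs = 0" using Xs_sol by (simp add: riccati_eq_Psi)
  \<comment> \<open>Monotonicity in the first argument, ending at \<open>Psi Xs Xs = 0\<close>,
    makes \<open>Xs\<close> a supersolution for every weight below it.\<close>
  have Psi_le: "x \<bullet> (Psi Y Xs *v x) \<le> 0" if "psd Y" "loewner_le Y Xs" for Y x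
    using Psi_mono[OF that(1) Xs_psd that(2) symXs, of x] by (simp add: Psi_Xs)
  have stable: "hurwitz (A + B ** gain Y Xs)" if "psd Y" "loewner_le Y Xs" for Y
    by (rule closed_loop_hurwitz[OF that(1) Xs_psd Psi_le[OF that]])
  have step: "sym_mat (X (Suc k))" "Psi (X k) (X (Suc k)) = 0"
    "hurwitz (A + B ** gain (X k) (X (Suc k)))" if "psd (X k)" for k
  proof -
    show s: "sym_mat (X (Suc k))" using X_step by (simp add: stabilizing_care_sol_def)
    show "Psi (X k) (X (Suc k)) = 0" "hurwitz (A + B ** gain (X k) (X (Suc k)))"
      using X_step[rule_format, of k] unfolding stabilizing_care_sol_def
      by (simp_all only: care_eq_Psi[OF that s] Ac_diff_Gc[OF that s])
  qed
  \<comment> \<open>\<open>X (Suc k)\<close> solves the equation of \<open>Psi (X k)\<close>, for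
    which \<open>X k\<close> is a subsolution and \<open>Xs\<close> a supersolution; each comparison
    uses the closed loop of the larger matrix.\<close>
  have succ: "loewner_le (X k) (X (Suc k))" "loewner_le (X (Suc k)) Xs"
    if "psd (X k)" "loewner_le (X k) Xs" "psd (Psi (X k) (X k))" for k
  proof -
    note step = step[OF that(1)]
    show "loewner_le (X k) (X (Suc k))"
      by (rule Psi_comparison[OF that(1) step(1) _ step(3)])
        (use that step(2) in \<open>auto simp: psd_def\<close>)
    show "loewner_le (X (Suc k)) Xs"
      by (rule Psi_comparison[OF that(1) symXs step(1) stable[OF that(1,2)] Psi_le[OF that(1,2)]])
        (simp add: step(2))
  qed
  have inv: "psd (X k) \<and> loewner_le (X k) Xs \<and> psd (Psi (X k) (X k))" for k
  proof (induction k)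
    case 0
    have z: "psd (0 :: real^'n^'n)" by (simp add: psd_def sym_mat_def transpose_def vec_eq_iff)
    then have sym0: "sym_mat (0 :: real^'n^'n)" by (simp add: psd_def)
    have "0 \<le> x \<bullet> (Psi 0 0 *v x)" for x
      unfolding ham_gain[OF z sym0, symmetric] ham_def
      using cost_nonneg noise_nonneg[OF z] by simp
    then show ?case using z Xs_psd sym_Psi[OF z sym0] by (simp add: X0 loewner_le_def psd_def)
  next
    case (Suc k)
    then have k: "psd (X k)" "loewner_le (X k) Xs" "psd (Psi (X k) (X k))" by auto
    note step = step[OF k(1)] and succ = succ[OF k]
    have "0 \<le> x \<bullet> (X (Suc k) *v x)" for x
    proof -
      have "0 \<le> x \<bullet> (X k *v x)" "0 \<le> x \<bullet> ((X (Suc k) - X k) *v x)"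
        using k(1) succ(1) by (auto simp: psd_def loewner_le_def)
      then show ?thesis by (simp add: matrix_vector_mult_diff_rdistrib inner_diff_right)
    qed
    then have p: "psd (X (Suc k))" using step(1) by (simp add: psd_def)
    \<comment> \<open>Raising the first argument from \<open>X k\<close> to \<open>X (Suc k)\<close>
      raises the form of \<open>Psi\<close> from zero, its value at the CARE solution.\<close>
    have "0 \<le> x \<bullet> (Psi (X (Suc k)) (X (Suc k)) *v x)" for x
      using Psi_mono[OF k(1) p succ(1) step(1), of x] by (simp add: step(2))
    then show ?case using p succ(2) sym_Psi[OF p step(1)] by (simp add: psd_def)
  qed
  have psd: "psd (X k)" and le: "loewner_le (X k) Xs" for k using inv by blast+
  have sym: "sym_mat (X k)" for k using psd[of k] by (simp add: psd_def)
  have mono: "loewner_le (X k) (X (Suc k))" for k using succ(1) inv by blast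
  have "convergent X" by (rule loewner_bounded_increasing_convergent[of X Xs]) (fact sym mono le)+
  then obtain Y where Y: "X \<longlonglongrightarrow> Y" by (auto simp: convergent_def)
  have psdY: "psd Y" by (rule psd_limit[OF Y psd])
  have "(\<lambda>k. Xs - X k) \<longlonglongrightarrow> Xs - Y" by (intro tendsto_intros Y)
  then have leY: "loewner_le Y Xs"
    unfolding loewner_le_def by (rule psd_limit) (use le in \<open>simp add: loewner_le_def\<close>)
  \<comment> \<open>The second argument runs through the shifted sequence, which has the same limit;
    along these pairs \<open>Psi\<close> is identically zero.\<close>
  have "x \<bullet> (Psi Y Y *v x) = 0" for x
    using Psi_form_tendsto[OF Y LIMSEQ_Suc[OF Y] psd, of x] step(2)[OF psd]
    by (simp add: LIMSEQ_const_iff)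
  then have "Y = Xs"
    by (intro psd_solution_unique[OF psdY Xs_psd leY]) (simp_all add: Psi_Xs)
  \<comment> \<open>Since \<open>Xs\<close> lies below itself, \<open>stable\<close> applies at the
    limit too, and its strict inequality gives the closed half-plane.\<close>
  moreover have "hurwitz (A + B ** gain Xs Xs)"
    by (rule stable[OF Xs_psd]) (simp add: loewner_le_def psd_def sym_mat_def transpose_def vec_eq_iff)
  ultimately show ?thesis
    using Y mono le inv Xs_psd stable[OF psd le]
    by (auto simp: riccati_eq_Psi Ac_diff_Gc[OF _ symXs] psd hurwitz_def intro: less_imp_le)
qed

end
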